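(* Let $u_1,u_2\in\mathbf{R}/\mathbf{Z}$ with $u_1\neq0$. Then \[ G^{(1)}_{u_1,u_2} G^{(2)}_{u_1,-u_2} - G^{(1)}_{u_1,-u_2} G^{(2)}_{u_1,u_2} = G^{(3)}_{0,u_2}. \]
   Context: Write $e(z)=e^{2\pi i z}$ and $q^\alpha = e(\alpha\tau)$ for $\tau$ in the upper half-plane, $\alpha\in\mathbf{R}$. For $t\in\mathbf{R}$, $\{t\}$ is the fractional part and $B_k$ the $k$-th Bernoulli polynomial ($B_1(t)=t-\frac12$). For an integer $k\ge1$ and $\mathbf{x}=(x_1,x_2)\in(\mathbf{R}/\mathbf{Z})^2$ define \[ G^{(k)}_{\mathbf x}(\tau)=a_0(G^{(k)}_{\mathbf x})+\sum_{\substack{m,n\in\mathbf{R}_{>0}\\ (m,n)\equiv \mathbf{x} \bmod 1}} m^{k-1}q^{mn}+(-1)^k\sum_{\substack{m,n\in\mathbf{R}_{>0}\\ (m,n)\equiv -\mathbf{x} \bmod 1}} m^{k-1}q^{mn}, \] where $a_0(G^{(1)}_{\mathbf x})=-B_1(\{x_2\})$ if $x_1=0\neq x_2$, $=-B_1(\{x_1\})$ if $x_1\ne0=x_2$, and $=0$ otherwise; and for $k\ge2$, $a_0(G^{(k)}_{\mathbf x})=-B_k(\{x_1\})/k$ if $x_2=0$ and $0$ if $x_2\neq0$. *)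

theory Defs
  imports
    "HOL-Analysis.Analysis"
    "HOL-Library.Real_Mod"
    "HOL-Computational_Algebra.Formal_Power_Series"
begin

(* B_k(t), from the generating function
   X exp(t X) / (exp(X) - 1) = sum over k of B_k(t) X^k / k!. *)
definition bernoulli_poly :: "nat \<Rightarrow> real \<Rightarrow> real" where
  "bernoulli_poly k t = fact k * fps_nth (fps_X * fps_exp t / (fps_exp 1 - 1)) k"

definition e2pi :: "complex \<Rightarrow> complex" where
  "e2pi z = exp (2 * of_real pi * \<i> * z)"

definition qpow :: "complex \<Rightarrow> real \<Rightarrow> complex" where
  "qpow \<tau> \<alpha> = e2pi (of_real \<alpha> * \<tau>)"

(* Elements of R/Z are given by real representatives and equality in R/Z is congruence
   mod 1; eisenstein_rcong below shows that only the classes of x1 and x2 matter. *)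

definition eis_index :: "real \<Rightarrow> real \<Rightarrow> (real \<times> real) set" where
  "eis_index x1 x2 = {(m, n). m > 0 \<and> n > 0 \<and> [m = x1] (rmod 1) \<and> [n = x2] (rmod 1)}"

definition eis_sum :: "nat \<Rightarrow> real \<Rightarrow> real \<Rightarrow> complex \<Rightarrow> complex" where
  "eis_sum k x1 x2 \<tau> =
     (\<Sum>\<^sub>\<infinity>(m, n)\<in>eis_index x1 x2. of_real (m ^ (k - 1)) * qpow \<tau> (m * n))"

definition eis_const :: "nat \<Rightarrow> real \<Rightarrow> real \<Rightarrow> real" where
  "eis_const k x1 x2 =
     (if k = 1 then
        if [x1 = 0] (rmod 1) \<and> \<not> [x2 = 0] (rmod 1) then - bernoulli_poly 1 (frac x2)
        else if \<not> [x1 = 0] (rmod 1) \<and> [x2 = 0] (rmod 1) then - bernoulli_poly 1 (frac x1)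
        else 0
      else
        if [x2 = 0] (rmod 1) then - bernoulli_poly k (frac x1) / real k else 0)"

(* The Eisenstein series of weight k and parameter (x1, x2); meaningful for k \<ge> 1 and
   Im \<tau> > 0, where both sums converge absolutely. *)
definition eisenstein :: "nat \<Rightarrow> real \<Rightarrow> real \<Rightarrow> complex \<Rightarrow> complex" where
  "eisenstein k x1 x2 \<tau> =
     of_real (eis_const k x1 x2) + eis_sum k x1 x2 \<tau> + (-1) ^ k * eis_sum k (- x1) (- x2) \<tau>"

lemma eisenstein_rcong:
  assumes "[x1 = y1] (rmod 1)" "[x2 = y2] (rmod 1)"
  shows "eisenstein k x1 x2 \<tau> = eisenstein k y1 y2 \<tau>"
proof -
  have fr: "frac x1 = frac y1" "frac x2 = frac y2"
    using assms by (simp_all add: rcong_def rmod_conv_frac)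
  have z: "[x1 = 0] (rmod 1) \<longleftrightarrow> [y1 = 0] (rmod 1)" "[x2 = 0] (rmod 1) \<longleftrightarrow> [y2 = 0] (rmod 1)"
    using assms by (simp_all add: rcong_def)
  have "[- x1 = - y1] (rmod 1)" "[- x2 = - y2] (rmod 1)"
    using assms by simp_all
  hence ix: "eis_index x1 x2 = eis_index y1 y2" "eis_index (- x1) (- x2) = eis_index (- y1) (- y2)"
    using assms by (simp_all add: eis_index_def rcong_def)
  show ?thesis
    unfolding eisenstein_def eis_sum_def eis_const_def fr z ix ..
qed

lemma bernoulli_poly_gen:
  "fps_X * fps_exp t = (fps_exp 1 - 1) * Abs_fps (\<lambda>k. bernoulli_poly k t / fact k)"
proof -
  let ?g = "fps_exp 1 - 1 :: real fps"
  let ?F = "fps_X * fps_exp t / ?g"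
  have g1: "fps_nth ?g 1 \<noteq> 0" by simp
  hence g: "?g \<noteq> 0" by (metis fps_zero_nth)
  have "subdegree ?g = 1" by (intro subdegreeI) auto
  moreover have "subdegree (fps_X * fps_exp t) = 1" by (intro subdegreeI) auto
  ultimately have "?g dvd fps_X * fps_exp t"
    using g by (subst fps_dvd_iff) auto
  hence "?g * ?F = fps_X * fps_exp t" by simp
  moreover have "Abs_fps (\<lambda>k. bernoulli_poly k t / fact k) = ?F"
    by (simp add: fps_eq_iff bernoulli_poly_def)
  ultimately show ?thesis by simp
qed

lemma bernoulli_poly_small:
  "bernoulli_poly 0 t = 1"
  "bernoulli_poly 1 t = t - 1 / 2"
  "bernoulli_poly 2 t = t\<^sup>2 - t + 1 / 6"
  "bernoulli_poly 3 t = t ^ 3 - 3 / 2 * t\<^sup>2 + t / 2"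
proof -
  let ?G = "Abs_fps (\<lambda>k. bernoulli_poly k t / fact k)"
  have eq: "fps_nth (fps_X * fps_exp t) n = fps_nth ((fps_exp 1 - 1) * ?G) n" for n
    by (subst bernoulli_poly_gen) (rule refl)
  show 0: "bernoulli_poly 0 t = 1"
    using eq[of 1] by (simp add: fps_mult_nth)
  show 1: "bernoulli_poly 1 t = t - 1 / 2"
    using eq[of 2] 0 by (simp add: fps_mult_nth numeral_eq_Suc)
  show 2: "bernoulli_poly 2 t = t\<^sup>2 - t + 1 / 6"
    using eq[of 3] 0 1 by (simp add: fps_mult_nth numeral_eq_Suc field_simps)
  show "bernoulli_poly 3 t = t ^ 3 - 3 / 2 * t\<^sup>2 + t / 2"
    using eq[of 4] 0 1 2 by (simp add: fps_mult_nth numeral_eq_Suc field_simps)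
qed

end

theory Submission
  imports Defs
begin

text \<open>
  Expand the left-hand side into sums over pairs (m1, n1), (m2, n2) of positive reals and
  substitute via m1 n1 + m2 n2 = (m1 - m2) n1 + m2 (n1 + n2) in the products of type
  eis_sum 1 x y * eis_sum 2 x (- y), where m1 - m2 and n1 + n2 are integers, and via
  m1 n1 + m2 n2 = m1 (n1 - n2) + (m1 + m2) n2 in the products of type
  eis_sum 1 x y * eis_sum 2 (- x) y. The exponent becomes m n + mu k with integers m, k > 0,
  restricted to n < k in the first case and to mu < m in the second. These two restricted
  sums agree: their complements inside the unrestricted sum are exchanged by the shift
  (n, mu) to (n - k, mu + m). All that survives are the terms with n1 = n2 of the second
  type, where m = m1 + m2 has exactly m decompositions because u1 is not 0 mod 1; they
  produce the coefficient m^2 of the weight 3 series.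
\<close>

section \<open>Positive representatives of a class mod 1\<close>

definition pos_class :: "real \<Rightarrow> real set" where
  "pos_class x = {m. m > 0 \<and> [m = x] (rmod 1)}"

lemma eis_index_eq: "eis_index x y = pos_class x \<times> pos_class y"
  by (auto simp: eis_index_def pos_class_def)

lemma pos_class_pos: "m \<in> pos_class x \<Longrightarrow> m > 0"
  by (simp add: pos_class_def)

lemma pos_class_add: "m \<in> pos_class x \<Longrightarrow> n \<in> pos_class y \<Longrightarrow> m + n \<in> pos_class (x + y)"
  by (auto simp: pos_class_def intro: rcong_add)

lemma pos_class_diff:
  "m \<in> pos_class x \<Longrightarrow> n \<in> pos_class y \<Longrightarrow> n < m \<Longrightarrow> m - n \<in> pos_class (x - y)"
  by (auto simp: pos_class_def intro: rcong_diff)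

lemma pos_class_add_0:
  assumes "m \<in> pos_class x" "k \<in> pos_class 0"
  shows "m + k \<in> pos_class x" "k + m \<in> pos_class x"
  using pos_class_add[OF assms] pos_class_add[OF assms(2,1)] by simp_all

lemma pos_class_add_minus:
  assumes "m \<in> pos_class x" "n \<in> pos_class (- x)"
  shows "m + n \<in> pos_class 0" "n + m \<in> pos_class 0"
  using pos_class_add[OF assms] pos_class_add[OF assms(2,1)] by simp_all

lemma pos_class_diff_same:
  "m \<in> pos_class x \<Longrightarrow> n \<in> pos_class x \<Longrightarrow> n < m \<Longrightarrow> m - n \<in> pos_class 0"
  using pos_class_diff[of m x n x] by simp

lemma pos_class_diff_0:
  "m \<in> pos_class x \<Longrightarrow> k \<in> pos_class 0 \<Longrightarrow> k < m \<Longrightarrow> m - k \<in> pos_class x"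
  using pos_class_diff[of m x k 0] by simp

lemma pos_class_0_diff:
  "m \<in> pos_class x \<Longrightarrow> k \<in> pos_class 0 \<Longrightarrow> m < k \<Longrightarrow> k - m \<in> pos_class (- x)"
  using pos_class_diff[of k 0 m x] by simp

lemmas pos_class_intros = pos_class_add_0 pos_class_add_minus pos_class_diff_same
  pos_class_diff_0 pos_class_0_diff

lemma pos_class_disjoint:
  "m \<in> pos_class x \<Longrightarrow> k \<in> pos_class 0 \<Longrightarrow> \<not> [x = 0] (rmod 1) \<Longrightarrow> m \<noteq> k"
  unfolding pos_class_def rcong_def by auto

text \<open>The offset \<open>1 - frac (- x)\<close> is the least positive representative: it lies
  in (0, 1] and equals 1, not 0, for integral \<open>x\<close>.\<close>

lemma pos_class_eq_range: "pos_class x = range (\<lambda>i::nat. (1 - frac (- x)) + real i)"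
proof (intro set_eqI iffI)
  fix m assume "m \<in> pos_class x"
  then have m: "m > 0" "[x = m] (rmod 1)" by (auto simp: pos_class_def rcong_sym_iff)
  then obtain n where n: "m = x + of_int n" by (auto simp: rcong_altdef)
  have eq: "m = (1 - frac (- x)) + of_int (n - 1 - \<lfloor>- x\<rfloor>)"
    by (simp add: n frac_def)
  have "real_of_int (n - 1 - \<lfloor>- x\<rfloor>) > -1"
    using eq m(1) frac_ge_0[of "- x"] by linarith
  then have "n - 1 - \<lfloor>- x\<rfloor> \<ge> 0" by linarith
  then obtain i where "n - 1 - \<lfloor>- x\<rfloor> = int i" using zero_le_imp_eq_int by blast
  with eq show "m \<in> range (\<lambda>i::nat. (1 - frac (- x)) + real i)" by auto
next
  fix m assume "m \<in> range (\<lambda>i::nat. (1 - frac (- x)) + real i)"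
  then obtain i where i: "m = (1 - frac (- x)) + real i" by auto
  have "m > 0" using frac_lt_1[of "- x"] i by linarith
  moreover have "m = x + of_int (1 + \<lfloor>- x\<rfloor> + int i) * 1" by (simp add: i frac_def)
  then have "[x = m] (rmod 1)" unfolding rcong_altdef by blast
  ultimately show "m \<in> pos_class x" by (simp add: pos_class_def rcong_sym_iff)
qed

text \<open>Each of the \<open>k\<close> unit intervals below the positive integer \<open>k\<close>
  contains exactly one representative. As it is not an integer, the strict bound
  \<open>m < k\<close> loses none of them.\<close>

lemma card_pos_class_less:
  assumes "\<not> [x = 0] (rmod 1)" and "k \<in> pos_class 0"
  shows "finite {m \<in> pos_class x. m < k}" "real (card {m \<in> pos_class x. m < k}) = k"
proof -
  obtain j where j: "k = 1 + real j" using assms(2) by (auto simp: pos_class_eq_range)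
  have "frac (- x) \<noteq> 0"
    using assms(1) rcong_uminus_uminus_iff[of x 0 1] by (auto simp: rcong_def rmod_conv_frac)
  then have fr: "0 < frac (- x)" "frac (- x) < 1"
    using frac_ge_0[of "- x"] frac_lt_1[of "- x"] by linarith+
  let ?f = "\<lambda>i::nat. (1 - frac (- x)) + real i"
  have *: "{m \<in> pos_class x. m < k} = ?f ` {..j}"
  proof -
    have "?f i < k \<longleftrightarrow> i \<le> j" for i using fr unfolding j by linarith
    then show ?thesis by (auto simp: pos_class_eq_range)
  qed
  show "finite {m \<in> pos_class x. m < k}" unfolding * by simp
  have "inj_on ?f {..j}" by (auto simp: inj_on_def)
  then show "real (card {m \<in> pos_class x. m < k}) = k"
    unfolding * by (simp add: card_image j)
qed

section \<open>Absolute convergence of the series and of their products\<close>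

lemma power_le_fact_exp:
  assumes "x \<ge> (0::real)"
  shows "x ^ n \<le> fact n * exp x"
proof -
  \<comment> \<open>A single term of the exponential series is at most the whole sum, all terms
    being nonnegative.\<close>
  have "(\<Sum>i\<in>{n}. x ^ i /\<^sub>R fact i) \<le> exp x"
    unfolding exp_def using assms
    by (intro sum_le_suminf summable_exp_generic) auto
  then show ?thesis by (simp add: field_simps)
qed

lemma qpow_add: "qpow \<tau> (a + b) = qpow \<tau> a * qpow \<tau> b"
  by (simp add: qpow_def e2pi_def exp_add[symmetric] algebra_simps)

lemma norm_qpow: "norm (qpow \<tau> a) = exp (- (2 * pi * Im \<tau>) * a)"
  by (simp add: qpow_def e2pi_def)

text \<open>Half of the exponential decay absorbs the power of \<open>m\<close>; the other half
  leaves a geometric series along the progression of representatives.\<close>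

lemma summable_on_pos_class_power_exp:
  assumes "c > (0::real)"
  shows "(\<lambda>m. m ^ j * exp (- c * m)) summable_on pos_class x"
proof -
  define p where "p = 1 - frac (- x)"
  have p: "p > 0" unfolding p_def using frac_lt_1[of "- x"] by simp
  define D where "D = fact j * (2 / c) ^ j"
  have bd: "m ^ j * exp (- c * m) \<le> D * exp (- (c / 2) * m)" if "m > 0" for m
  proof -
    have "(c / 2 * m) ^ j \<le> fact j * exp (c / 2 * m)"
      using that assms by (intro power_le_fact_exp) simp
    then have "m ^ j \<le> D * exp (c / 2 * m)"
      using assms by (simp add: D_def power_mult_distrib power_divide field_simps)
    then have "m ^ j * exp (- c * m) \<le> D * exp (c / 2 * m) * exp (- c * m)"
      by (rule mult_right_mono) simp
    also have "\<dots> = D * exp (- (c / 2) * m)" by (simp add: exp_add[symmetric])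
    finally show ?thesis .
  qed
  have "summable (\<lambda>i. D * exp (- (c / 2) * p) * exp (- (c / 2)) ^ i)"
    using assms by (intro summable_mult summable_geometric) simp
  also have "(\<lambda>i. D * exp (- (c / 2) * p) * exp (- (c / 2)) ^ i)
      = (\<lambda>i. D * exp (- (c / 2) * (p + real i)))"
    by (simp add: fun_eq_iff exp_of_nat_mult[symmetric] exp_add[symmetric] algebra_simps)
  finally have "summable (\<lambda>i. norm ((p + real i) ^ j * exp (- c * (p + real i))))"
  proof (rule summable_comparison_test[rotated], intro exI allI impI)
    fix i
    have "p + real i > 0" using p by simp
    then show "norm (norm ((p + real i) ^ j * exp (- c * (p + real i))))
        \<le> D * exp (- (c / 2) * (p + real i))"
      using bd[of "p + real i"] by (simp add: abs_mult)
  qed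
  then have "(\<lambda>i. (p + real i) ^ j * exp (- c * (p + real i))) summable_on UNIV"
    by (rule norm_summable_imp_summable_on)
  moreover have "inj (\<lambda>i. p + real i)" by (auto simp: inj_def)
  ultimately show ?thesis
    unfolding pos_class_eq_range p_def[symmetric]
    by (subst summable_on_reindex) (auto simp: o_def)
qed

lemma abs_summable_on_product:
  fixes f :: "'a \<Rightarrow> 'c::{real_normed_field,banach}" and g :: "'b \<Rightarrow> 'c"
  assumes "(\<lambda>x. norm (f x)) summable_on A"
    and "(\<lambda>y. norm (g y)) summable_on B"
  shows "(\<lambda>z. norm ((\<lambda>(x, y). f x * g y) z)) summable_on A \<times> B"
  unfolding Infinite_Sum.abs_summable_on_Sigma_iff
  using assms
  by (auto simp: norm_mult infsum_cmult_right' abs_mult infsum_nonneg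
      intro!: summable_on_cmult_right summable_on_cmult_left)

lemma infsum_product_abs:
  fixes f :: "'a \<Rightarrow> 'c::{real_normed_field,banach}" and g :: "'b \<Rightarrow> 'c"
  assumes "(\<lambda>x. norm (f x)) summable_on A"
    and "(\<lambda>y. norm (g y)) summable_on B"
  shows "(\<Sum>\<^sub>\<infinity>(x, y)\<in>A \<times> B. f x * g y) = infsum f A * infsum g B"
proof -
  have "(\<lambda>(x, y). f x * g y) summable_on A \<times> B"
    by (rule abs_summable_summable) (rule abs_summable_on_product[OF assms])
  from infsum_Sigma'_banach[OF this] show ?thesis
    by (simp add: infsum_cmult_right' infsum_cmult_left')
qed

definition eis_term :: "nat \<Rightarrow> complex \<Rightarrow> real \<times> real \<Rightarrow> complex" where
  "eis_term k \<tau> = (\<lambda>(m, n). of_real (m ^ (k - 1)) * qpow \<tau> (m * n))"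

lemma eis_sum_eq: "eis_sum k x y \<tau> = infsum (eis_term k \<tau>) (eis_index x y)"
  by (simp add: eis_sum_def eis_term_def)

text \<open>With least representatives \<open>p\<close> and \<open>r\<close>, the product
  \<open>m * n\<close> is at least \<open>m * r\<close> and at least \<open>p * n\<close>. The
  average of the two bounds separates the variables in the exponent, so a product of two
  one-variable series dominates.\<close>

lemma abs_summable_eis_term:
  assumes "Im \<tau> > 0"
  shows "(\<lambda>z. norm (eis_term k \<tau> z)) summable_on eis_index x y"
proof -
  define p where "p = 1 - frac (- x)"
  define r where "r = 1 - frac (- y)"
  define c where "c = 2 * pi * Im \<tau>"
  have pos: "p > 0" "r > 0" "c > 0"
    using frac_lt_1[of "- x"] frac_lt_1[of "- y"] assms by (auto simp: p_def r_def c_def)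
  let ?f = "\<lambda>m. m ^ (k - 1) * exp (- (c * r / 2) * m)"
  \<comment> \<open>The factor \<open>n ^ 0\<close> gives this the shape of the one-variable series
    with exponent 0.\<close>
  let ?g = "\<lambda>n. n ^ 0 * exp (- (c * p / 2) * n)"
  have "(\<lambda>z. norm ((\<lambda>(m, n). ?f m * ?g n) z)) summable_on pos_class x \<times> pos_class y"
    using pos
    by (intro abs_summable_on_product summable_on_iff_abs_summable_on_real[THEN iffD1]
        summable_on_pos_class_power_exp) auto
  then show ?thesis
    unfolding eis_index_eq
  proof (rule Infinite_Sum.abs_summable_on_comparison_test)
    fix z assume "z \<in> pos_class x \<times> pos_class y"
    then obtain m n where z: "z = (m, n)" "m \<in> pos_class x" "n \<in> pos_class y" by auto
    then have mn: "m \<ge> p" "n \<ge> r" by (auto simp: pos_class_eq_range p_def r_def)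
    have "m * r \<le> m * n" "p * n \<le> m * n"
      using mn pos by (auto intro!: mult_left_mono mult_right_mono)
    then have "c * ((m * r + p * n) / 2) \<le> c * (m * n)"
      using pos by (intro mult_left_mono) auto
    then have "exp (- c * (m * n)) \<le> exp (- (c * r / 2) * m + - (c * p / 2) * n)"
      by (simp add: field_simps)
    then have "exp (- c * (m * n)) \<le> exp (- (c * r / 2) * m) * exp (- (c * p / 2) * n)"
      by (simp only: exp_add)
    then have "m ^ (k - 1) * exp (- c * (m * n))
        \<le> m ^ (k - 1) * (exp (- (c * r / 2) * m) * exp (- (c * p / 2) * n))"
      using mn pos by (intro mult_left_mono) simp_all
    moreover have "m > 0" "n > 0" using mn pos by auto
    moreover have "norm (qpow \<tau> (m * n)) = exp (- c * (m * n))"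
      by (simp only: norm_qpow c_def)
    ultimately show "norm (eis_term k \<tau> z) \<le> norm ((\<lambda>(m, n). ?f m * ?g n) z)"
      by (simp add: z eis_term_def norm_mult norm_power mult_ac)
  qed
qed

section \<open>Restricted lattice sums and their symmetry\<close>

definition lattice_term :: "complex \<Rightarrow> (real \<times> real) \<times> (real \<times> real) \<Rightarrow> complex" where
  "lattice_term \<tau> = (\<lambda>((m, n), (\<mu>, k)). of_real m * qpow \<tau> (m * n + \<mu> * k))"

text \<open>Summing \<open>lattice_term\<close> over this set expands
  \<open>eis_sum 2 0 y \<tau> * eis_sum 1 x 0 \<tau>\<close>; \<open>m\<close> and \<open>k\<close>
  are the integral coordinates.\<close>

definition lattice_index :: "real \<Rightarrow> real \<Rightarrow> ((real \<times> real) \<times> (real \<times> real)) set" where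
  "lattice_index x y = eis_index 0 y \<times> eis_index x 0"

text \<open>The condition \<open>\<mu> < m\<close> allows \<open>m\<close> to be split into the
  positive parts \<open>\<mu>\<close> and \<open>m - \<mu>\<close>, as needed for products with
  opposite first parameters. In \<open>col_sum\<close>, \<open>n < k\<close> splits \<open>k\<close>
  for opposite second parameters.\<close>

definition row_sum :: "real \<Rightarrow> real \<Rightarrow> complex \<Rightarrow> complex" where
  "row_sum x y \<tau> = infsum (lattice_term \<tau>) {((m, n), (\<mu>, k)) \<in> lattice_index x y. \<mu> < m}"

definition col_sum :: "real \<Rightarrow> real \<Rightarrow> complex \<Rightarrow> complex" where
  "col_sum x y \<tau> = infsum (lattice_term \<tau>) {((m, n), (\<mu>, k)) \<in> lattice_index x y. n < k}"

lemma summable_on_eis_product: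
  assumes "Im \<tau> > 0"
  shows "(\<lambda>(z, w). eis_term j \<tau> z * eis_term k \<tau> w) summable_on eis_index a b \<times> eis_index c d"
  by (rule abs_summable_summable) (intro abs_summable_on_product abs_summable_eis_term assms)

lemma infsum_eis_product:
  assumes "Im \<tau> > 0"
  shows "(\<Sum>\<^sub>\<infinity>(z, w)\<in>eis_index a b \<times> eis_index c d. eis_term j \<tau> z * eis_term k \<tau> w)
    = eis_sum j a b \<tau> * eis_sum k c d \<tau>"
  unfolding eis_sum_eq by (intro infsum_product_abs abs_summable_eis_term assms)

lemma summable_lattice_term:
  assumes "Im \<tau> > 0"
  shows "lattice_term \<tau> summable_on lattice_index x y"
proof -
  have "lattice_term \<tau> = (\<lambda>(z, w). eis_term 2 \<tau> z * eis_term 1 \<tau> w)"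
    by (auto simp: lattice_term_def eis_term_def qpow_add mult_ac)
  then show ?thesis
    unfolding lattice_index_def using summable_on_eis_product[OF assms] by simp
qed

lemma row_sum_eq_col_sum:
  assumes "Im \<tau> > 0" "\<not> [x = 0] (rmod 1)" "\<not> [y = 0] (rmod 1)"
  shows "row_sum x y \<tau> = col_sum x y \<tau>"
proof -
  let ?L = "lattice_index x y"
  define R where "R = {((m, n), (\<mu>, k)) \<in> ?L. \<mu> < m}"
  define R' where "R' = {((m, n), (\<mu>, k)) \<in> ?L. m < \<mu>}"
  define C where "C = {((m, n), (\<mu>, k)) \<in> ?L. n < k}"
  define C' where "C' = {((m, n), (\<mu>, k)) \<in> ?L. k < n}"
  have sub: "R \<subseteq> ?L" "R' \<subseteq> ?L" "C \<subseteq> ?L" "C' \<subseteq> ?L"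
    by (auto simp: R_def R'_def C_def C'_def)
  have summ: "lattice_term \<tau> summable_on S" if "S \<subseteq> ?L" for S
    using summable_on_subset_banach[OF summable_lattice_term[OF assms(1)] that] .
  \<comment> \<open>The boundary cases \<open>\<mu> = m\<close> and \<open>n = k\<close> never
    occur: \<open>m\<close> and \<open>k\<close> are integers, \<open>\<mu>\<close> and
    \<open>n\<close> are not.\<close>
  have R: "R \<inter> R' = {}" "R \<union> R' = ?L"
    using pos_class_disjoint[OF _ _ assms(2)]
    by (fastforce simp: R_def R'_def lattice_index_def eis_index_eq)+
  have C: "C \<inter> C' = {}" "C \<union> C' = ?L"
    using pos_class_disjoint[OF _ _ assms(3)]
    by (fastforce simp: C_def C'_def lattice_index_def eis_index_eq)+
  \<comment> \<open>The shift fixes the coefficient \<open>m\<close> and also the exponent, since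
    \<open>m * (n - k) + (\<mu> + m) * k = m * n + \<mu> * k\<close>.\<close>
  have "infsum (lattice_term \<tau>) C' = infsum (lattice_term \<tau>) R'"
    by (rule infsum_reindex_bij_witness
        [of _ "\<lambda>((m, n), (\<mu>, k)). ((m, n + k), (\<mu> - m, k))"
              "\<lambda>((m, n), (\<mu>, k)). ((m, n - k), (\<mu> + m, k))"])
      (auto simp: C'_def R'_def lattice_index_def eis_index_eq lattice_term_def algebra_simps
        intro: pos_class_intros dest: pos_class_pos)
  moreover have "infsum (lattice_term \<tau>) ?L
      = infsum (lattice_term \<tau>) R + infsum (lattice_term \<tau>) R'"
    using infsum_Un_disjoint[OF summ summ R(1)] sub R(2) by simp
  moreover have "infsum (lattice_term \<tau>) ?L
      = infsum (lattice_term \<tau>) C + infsum (lattice_term \<tau>) C'"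
    using infsum_Un_disjoint[OF summ summ C(1)] sub C(2) by simp
  ultimately show ?thesis by (simp add: row_sum_def col_sum_def R_def C_def)
qed

section \<open>Products of weight 1 and weight 2 sums\<close>

lemma infsum_split3:
  fixes f :: "'a \<Rightarrow> 'b::banach" and h :: "'a \<Rightarrow> real"
  assumes "f summable_on S"
  shows "infsum f S = infsum f {z \<in> S. h z < 0} + infsum f {z \<in> S. h z = 0}
    + infsum f {z \<in> S. h z > 0}"
proof -
  have summ: "f summable_on T" if "T \<subseteq> S" for T
    using summable_on_subset_banach[OF assms that] .
  have "infsum f ({z \<in> S. h z < 0} \<union> {z \<in> S. h z = 0})
      = infsum f {z \<in> S. h z < 0} + infsum f {z \<in> S. h z = 0}"
    by (rule infsum_Un_disjoint) (auto intro!: summ)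
  moreover have "infsum f ({z \<in> S. h z < 0} \<union> {z \<in> S. h z = 0} \<union> {z \<in> S. h z > 0})
      = infsum f ({z \<in> S. h z < 0} \<union> {z \<in> S. h z = 0}) + infsum f {z \<in> S. h z > 0}"
    by (rule infsum_Un_disjoint) (auto intro!: summ)
  moreover have "{z \<in> S. h z < 0} \<union> {z \<in> S. h z = 0} \<union> {z \<in> S. h z > 0} = S"
    by auto
  ultimately show ?thesis by simp
qed

text \<open>The antisymmetric combination has coefficient \<open>m2 - m1\<close>, which is an
  integer and vanishes on the diagonal \<open>m1 = m2\<close>. Each sign of it yields one
  \<open>col_sum\<close>, with \<open>m\<close> the absolute difference and \<open>n\<close> the
  partner of the larger of \<open>m1\<close>, \<open>m2\<close>.\<close>

lemma eis_product_diff: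
  assumes "Im \<tau> > 0"
  shows "eis_sum 1 x y \<tau> * eis_sum 2 x (- y) \<tau> - eis_sum 2 x y \<tau> * eis_sum 1 x (- y) \<tau>
    = col_sum x (- y) \<tau> - col_sum x y \<tau>"
proof -
  let ?D = "eis_index x y \<times> eis_index x (- y)"
  let ?f = "\<lambda>((m1, n1), (m2, n2)). of_real (m2 - m1) * qpow \<tau> (m1 * n1 + m2 * n2)"
  let ?p = "\<lambda>j k (z, w). eis_term j \<tau> z * eis_term k \<tau> w"
  have f: "?f = (\<lambda>z. ?p 1 2 z - ?p 2 1 z)"
    by (auto simp: eis_term_def qpow_add fun_eq_iff algebra_simps)
  have "(?p 1 2 has_sum eis_sum 1 x y \<tau> * eis_sum 2 x (- y) \<tau>) ?D"
    "(?p 2 1 has_sum eis_sum 2 x y \<tau> * eis_sum 1 x (- y) \<tau>) ?D"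
    unfolding infsum_eis_product[OF assms, symmetric]
    by (intro has_sum_infsum summable_on_eis_product assms)+
  from has_sum_add[OF this(1) has_sum_uminusI[OF this(2)]]
  have hs: "(?f has_sum (eis_sum 1 x y \<tau> * eis_sum 2 x (- y) \<tau>
      - eis_sum 2 x y \<tau> * eis_sum 1 x (- y) \<tau>)) ?D"
    unfolding f by simp
  then have summ: "?f summable_on ?D" by (rule has_sum_imp_summable)
  have "eis_sum 1 x y \<tau> * eis_sum 2 x (- y) \<tau> - eis_sum 2 x y \<tau> * eis_sum 1 x (- y) \<tau>
      = infsum ?f ?D"
    by (rule infsumI[OF hs, symmetric])
  also have "\<dots> = infsum ?f {z \<in> ?D. (\<lambda>((m1, n1), (m2, n2)). m1 - m2) z < 0}
      + infsum ?f {z \<in> ?D. (\<lambda>((m1, n1), (m2, n2)). m1 - m2) z = 0}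
      + infsum ?f {z \<in> ?D. (\<lambda>((m1, n1), (m2, n2)). m1 - m2) z > 0}"
    by (rule infsum_split3[OF summ])
  also have "infsum ?f {z \<in> ?D. (\<lambda>((m1, n1), (m2, n2)). m1 - m2) z = 0} = 0"
    by (rule infsum_0) auto
  also have "infsum ?f {z \<in> ?D. (\<lambda>((m1, n1), (m2, n2)). m1 - m2) z < 0} = col_sum x (- y) \<tau>"
    unfolding col_sum_def
    \<comment> \<open>Here \<open>k - n\<close> lies in the class of \<open>- (- y)\<close>; the
      simplified instance of \<open>pos_class_0_diff\<close> turns this into
      \<open>y\<close>.\<close>
    by (rule infsum_reindex_bij_witness
        [of _ "\<lambda>((m, n), (\<mu>, k)). ((\<mu>, k - n), (\<mu> + m, n))"
              "\<lambda>((m1, n1), (m2, n2)). ((m2 - m1, n2), (m1, n1 + n2))"])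
      (auto simp: lattice_index_def eis_index_eq lattice_term_def algebra_simps
        intro: pos_class_intros pos_class_0_diff[of _ "- y", simplified] dest: pos_class_pos)
  also have "infsum ?f {z \<in> ?D. (\<lambda>((m1, n1), (m2, n2)). m1 - m2) z > 0}
      = (\<Sum>\<^sub>\<infinity>z\<in>{((m, n), (\<mu>, k)) \<in> lattice_index x y. n < k}. - lattice_term \<tau> z)"
    by (rule infsum_reindex_bij_witness
        [of _ "\<lambda>((m, n), (\<mu>, k)). ((\<mu> + m, n), (\<mu>, k - n))"
              "\<lambda>((m1, n1), (m2, n2)). ((m1 - m2, n1), (m2, n1 + n2))"])
      (auto simp: lattice_index_def eis_index_eq lattice_term_def algebra_simps
        intro: pos_class_intros dest: pos_class_pos)
  also have "\<dots> = - col_sum x y \<tau>"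
    by (simp add: col_sum_def infsum_uminus)
  finally show ?thesis by simp
qed

text \<open>The symmetric combination has the integral coefficient \<open>m1 + m2\<close>, which
  does not vanish for \<open>n1 = n2\<close>. The two signs of \<open>n1 - n2\<close> give the row
  sums, and the diagonal gives the weight 3 sum.\<close>

lemma eis_product_add:
  assumes "Im \<tau> > 0" "\<not> [x = 0] (rmod 1)"
  shows "eis_sum 1 x y \<tau> * eis_sum 2 (- x) y \<tau> + eis_sum 2 x y \<tau> * eis_sum 1 (- x) y \<tau>
    = row_sum x y \<tau> + row_sum (- x) y \<tau> + eis_sum 3 0 y \<tau>"
proof -
  let ?D = "eis_index x y \<times> eis_index (- x) y"
  let ?f = "\<lambda>((m1, n1), (m2, n2)). of_real (m1 + m2) * qpow \<tau> (m1 * n1 + m2 * n2)"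
  let ?p = "\<lambda>j k (z, w). eis_term j \<tau> z * eis_term k \<tau> w"
  let ?h = "\<lambda>((m1, n1), (m2, n2)). n1 - n2"
  have f: "?f = (\<lambda>z. ?p 1 2 z + ?p 2 1 z)"
    by (auto simp: eis_term_def qpow_add fun_eq_iff algebra_simps)
  have "(\<lambda>z. ?p 1 2 z + ?p 2 1 z) summable_on ?D"
    using assms by (intro summable_on_add summable_on_eis_product)
  then have summ: "?f summable_on ?D" unfolding f .
  have "eis_sum 1 x y \<tau> * eis_sum 2 (- x) y \<tau> + eis_sum 2 x y \<tau> * eis_sum 1 (- x) y \<tau>
      = infsum ?f ?D"
    unfolding f infsum_eis_product[OF assms(1), symmetric]
    by (rule infsum_add[symmetric]) (intro summable_on_eis_product assms)+
  also have "\<dots> = infsum ?f {z \<in> ?D. ?h z < 0} + infsum ?f {z \<in> ?D. ?h z = 0}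
      + infsum ?f {z \<in> ?D. ?h z > 0}"
    by (rule infsum_split3[OF summ])
  also have "infsum ?f {z \<in> ?D. ?h z < 0} = row_sum (- x) y \<tau>"
    unfolding row_sum_def
    by (rule infsum_reindex_bij_witness
        [of _ "\<lambda>((m, n), (\<mu>, k)). ((m - \<mu>, n), (\<mu>, n + k))"
              "\<lambda>((m1, n1), (m2, n2)). ((m1 + m2, n1), (m2, n2 - n1))"])
      (auto simp: lattice_index_def eis_index_eq lattice_term_def algebra_simps
        intro: pos_class_intros pos_class_0_diff[of _ "- x", simplified] dest: pos_class_pos)
  also have "infsum ?f {z \<in> ?D. ?h z > 0} = row_sum x y \<tau>"
    unfolding row_sum_def
    by (rule infsum_reindex_bij_witness
        [of _ "\<lambda>((m, n), (\<mu>, k)). ((\<mu>, n + k), (m - \<mu>, n))"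
              "\<lambda>((m1, n1), (m2, n2)). ((m1 + m2, n2), (m1, n1 - n2))"])
      (auto simp: lattice_index_def eis_index_eq lattice_term_def algebra_simps
        intro: pos_class_intros dest: pos_class_pos)
  also have "infsum ?f {z \<in> ?D. ?h z = 0} = eis_sum 3 0 y \<tau>"
  proof -
    \<comment> \<open>On the diagonal the exponent is \<open>(m1 + m2) * n\<close>, so a term
      depends only on \<open>m = m1 + m2\<close> and \<open>n\<close>; the extra variable
      \<open>\<mu> = m1\<close> enumerates the decompositions of \<open>m\<close>.\<close>
    let ?g = "\<lambda>((m, n), \<mu>). of_real m * qpow \<tau> (m * n)"
    let ?S = "SIGMA z:eis_index 0 y. {\<mu> \<in> pos_class x. \<mu> < fst z}"
    let ?i = "\<lambda>((m, n), \<mu>). ((\<mu>, n), (m - \<mu>, n))"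
    let ?j = "\<lambda>((m1, n1), (m2, n2)). ((m1 + m2, n1), m1)"
    have z: "?i (?j z) = z" "?j z \<in> ?S" "?g (?j z) = ?f z" if "z \<in> {z \<in> ?D. ?h z = 0}" for z
      using that by (auto simp: eis_index_eq algebra_simps intro: pos_class_intros dest: pos_class_pos)
    have w: "?j (?i w) = w" "?i w \<in> {z \<in> ?D. ?h z = 0}" if "w \<in> ?S" for w
      using that by (auto simp: eis_index_eq intro: pos_class_intros)
    have eq: "infsum ?f {z \<in> ?D. ?h z = 0} = infsum ?g ?S"
      by (rule infsum_reindex_bij_witness[of _ ?i ?j]) (fact z w)+
    \<comment> \<open>Summability is carried over to \<open>?S\<close> so that the sum may be taken
      fibre by fibre.\<close>
    have "?f summable_on {z \<in> ?D. ?h z = 0}"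
      by (rule summable_on_subset_banach[OF summ]) auto
    moreover have "?f summable_on {z \<in> ?D. ?h z = 0} \<longleftrightarrow> ?g summable_on ?S"
      by (rule summable_on_reindex_bij_witness[of _ ?i ?j]) (fact z w)+
    ultimately have "?g summable_on ?S" by simp
    from infsum_Sigma_banach[OF this]
    have "infsum ?g ?S = (\<Sum>\<^sub>\<infinity>z\<in>eis_index 0 y. \<Sum>\<^sub>\<infinity>\<mu>\<in>{\<mu> \<in> pos_class x. \<mu> < fst z}. ?g (z, \<mu>))"
      by simp
    also have "\<dots> = eis_sum 3 0 y \<tau>"
      unfolding eis_sum_eq
    proof (rule infsum_cong)
      fix z assume "z \<in> eis_index 0 y"
      then obtain m n where z: "z = (m, n)" "m \<in> pos_class 0" by (auto simp: eis_index_eq)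
      note less = card_pos_class_less[OF assms(2) z(2)]
      have "(\<Sum>\<^sub>\<infinity>\<mu>\<in>{\<mu> \<in> pos_class x. \<mu> < fst z}. ?g (z, \<mu>))
          = of_real (real (card {\<mu> \<in> pos_class x. \<mu> < m})) * (of_real m * qpow \<tau> (m * n))"
        using less(1) by (simp add: z)
      \<comment> \<open>The \<open>m\<close> decompositions, each of weight \<open>m\<close>,
        produce \<open>m ^ (3 - 1)\<close>.\<close>
      also have "\<dots> = eis_term 3 \<tau> z"
        unfolding less(2) by (simp add: z eis_term_def power2_eq_square)
      finally show "(\<Sum>\<^sub>\<infinity>\<mu>\<in>{\<mu> \<in> pos_class x. \<mu> < fst z}. ?g (z, \<mu>)) = eis_term 3 \<tau> z" .
    qed
    finally show ?thesis using eq by simp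
  qed
  finally show ?thesis by simp
qed

section \<open>Constant terms and the combination of the product identities\<close>

theorem theorem6p4:
  fixes u1 u2 :: real and \<tau> :: complex
  assumes "\<not> [u1 = 0] (rmod 1)" and "Im \<tau> > 0"
  shows "eisenstein 1 u1 u2 \<tau> * eisenstein 2 u1 (- u2) \<tau>
         - eisenstein 1 u1 (- u2) \<tau> * eisenstein 2 u1 u2 \<tau>
       = eisenstein 3 0 u2 \<tau>"
proof (cases "[u2 = 0] (rmod 1)")
  case True
  then have "[- u2 = - 0] (rmod 1)" by (simp only: rcong_uminus_uminus_iff)
  then have 0: "[- u2 = 0] (rmod 1)" by simp
  \<comment> \<open>For integral \<open>u2\<close> the sign of \<open>u2\<close> is immaterial, so
    the left-hand side cancels.\<close>
  have "eisenstein k x u2 \<tau> = eisenstein k x 0 \<tau>" "eisenstein k x (- u2) \<tau> = eisenstein k x 0 \<tau>"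
    for k x using True 0 by (auto intro: eisenstein_rcong)
  \<comment> \<open>The third Bernoulli polynomial vanishes at 0, and the two sums cancel because
    the weight is odd.\<close>
  moreover have "eisenstein 3 0 0 \<tau> = 0"
    by (simp add: eisenstein_def eis_const_def bernoulli_poly_small)
  ultimately show ?thesis by simp
next
  case False
  have neg: "\<not> [- u1 = 0] (rmod 1)" "\<not> [- u2 = 0] (rmod 1)"
    using assms(1) False by (simp_all add: rcong_uminus_left_iff)
  note row_col = row_sum_eq_col_sum[OF assms(2)]
  note rc = row_col[OF assms(1) False] row_col[OF assms(1) neg(2)]
    row_col[OF neg(1) False] row_col[OF neg]
  \<comment> \<open>All constant terms vanish: in weight 1 neither parameter is 0 mod 1, and in
    weights 2 and 3 the second one is not.\<close>
  have e1: "eisenstein 1 u1 y \<tau> = eis_sum 1 u1 y \<tau> - eis_sum 1 (- u1) (- y) \<tau>"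
    if "\<not> [y = 0] (rmod 1)" for y
    using that assms(1) by (simp add: eisenstein_def eis_const_def)
  have e2: "eisenstein 2 u1 y \<tau> = eis_sum 2 u1 y \<tau> + eis_sum 2 (- u1) (- y) \<tau>"
    if "\<not> [y = 0] (rmod 1)" for y
    using that by (simp add: eisenstein_def eis_const_def)
  have e3: "eisenstein 3 0 u2 \<tau> = eis_sum 3 0 u2 \<tau> - eis_sum 3 0 (- u2) \<tau>"
    using False by (simp add: eisenstein_def eis_const_def)
  show ?thesis
    \<comment> \<open>The eight products on the left are the two difference identities plus the sum
      identity at \<open>u2\<close> minus the one at \<open>- u2\<close>. After \<open>rc\<close>
      turns row sums into column sums, these cancel in pairs and only the weight 3 sums
      remain.\<close>
    using eis_product_diff[OF assms(2), of u1 u2] eis_product_diff[OF assms(2), of "- u1" u2]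
      eis_product_add[OF assms(2,1), of u2] eis_product_add[OF assms(2,1), of "- u2"]
    unfolding e1[OF False] e1[OF neg(2)] e2[OF False] e2[OF neg(2)] e3 rc minus_minus
    by (simp only: algebra_simps) algebra
qed

end
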